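(* Assume that $I$ is centered at $0$ with $[-1,1]\subseteq I$. Let $f\colon I^n\to\mathbb{R}$ be a function and let $f_0=f-f(\mathbf{0})$. Then $f$ is a symmetric Lovász extension if and only if the following conditions hold: (i) $f_0$ is horizontally median-additive. (ii) Each of the maps $\delta_{f_0}^A|_{I_+}$ and $\delta_{f_0}^A|_{I_-}$ $(A\subseteq[n])$ is continuous at a point or monotonic or Lebesgue measurable or bounded from one side on a set of positive measure. (iii) $\delta_{f_0}^A(-1)=-\delta_{f_0}^A(1)$ for every $A\subseteq[n]$. Conditions (ii) and (iii) hold together if and only if $\delta_{f_0}^A$ is homogeneous of degree one for every $A\subseteq[n]$.
   Context: $n\geq 1$ is an integer, $[n]=\{1,\ldots,n\}$, $S_n$ is the set of permutations of $[n]$, and $I$ is a nontrivial (i.e., of positive measure) real interval, possibly unbounded, containing $0$; "centered at $0$" means $-x\in I$ for every $x\in I$. $I_+=I\cap[0,+\infty[$, $I_-=I\cap\,]-\infty,0]$, $\mathbf{0}=(0,\ldots,0)$. For $A\subseteq[n]$, $\mathbf{1}_A$ is the $n$-tuple whose $i$th component is $1$ if $i\in A$ and $0$ otherwise; for $g\colon I^n\to\mathbb{R}$, $\delta_g^A\colon I\to\mathbb{R}$ is defined by $\delta_g^A(x)=g(x\mathbf{1}_A)$. A function $u\colon I\to\mathbb{R}$ is homogeneous of degree one if $u(cx)=c\,u(x)$ for every $x\in I$ and every $c\in\mathbb{R}$ such that $cx\in I$. For $\mathbf{x}\in\mathbb{R}^n$ and $c\in\mathbb{R}$, $\mathbf{x}\wedge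 c$ (resp. $\mathbf{x}\vee c$) is the $n$-tuple whose $i$th component is $\min(x_i,c)$ (resp. $\max(x_i,c)$); $\mathbf{x}^+=\mathbf{x}\vee 0$, $\mathbf{x}^-=(-\mathbf{x})^+$, $[\mathbf{x}]_c=\mathbf{x}-(\mathbf{x}\wedge c)$, $[\mathbf{x}]^c=\mathbf{x}-(\mathbf{x}\vee c)$. For $c\geq 0$, $\mathrm{med}(-c,\mathbf{x},c)$ is the $n$-tuple whose $i$th component is the middle value of $-c,x_i,c$. A function $g\colon I^n\to\mathbb{R}$ (with $I$ centered at $0$) is horizontally median-additive if $g(\mathbf{x})=g(\mathrm{med}(-c,\mathbf{x},c))+g([\mathbf{x}]_c)+g([\mathbf{x}]^{-c})$ for every $\mathbf{x}\in I^n$ and every $c\in I_+$. For $\sigma\in S_n$, $\mathbb{R}^n_\sigma=\{\mathbf{x}\in\mathbb{R}^n : x_{\sigma(1)}\leq\cdots\leq x_{\sigma(n)}\}$. For $\phi\colon\{0,1\}^n\to\mathbb{R}$, the Lovász extension $f_\phi\colon\mathbb{R}^n\to\mathbb{R}$ of $\phi$ is the function whose restriction to each $\mathbb{R}^n_\sigma$ ($\sigma\in S_n$) is the unique affine function agreeing with $\phi$ at the $n+1$ vertices of the simplex $[0,1]^n\cap\mathbb{R}^n_\sigma$. The symmetric Lovász extension of $\phi$ is the function $\check{f}_\phi\colon\mathbb{R}^n\to\mathbb{R}$ defined by $\check{f}_\phi(\mathbf{x})=f_\phi(\mathbf{0})+f_\phi(\mathbf{x}^+)-f_\phi(\mathbf{x}^-)$.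 A function $\mathbb{R}^n\to\mathbb{R}$ is a symmetric Lovász extension if it equals $\check{f}_\phi$ for some $\phi\colon\{0,1\}^n\to\mathbb{R}$. A function $f\colon I^n\to\mathbb{R}$ is a symmetric Lovász extension if it is the restriction to $I^n$ of a symmetric Lovász extension on $\mathbb{R}^n$.
   Formalization: The last sentence, that (ii) and (iii) hold together iff every δ is homogeneous of degree one, is stated and proved only under condition (i); without (i) it fails, e.g. for n = 1 and f(x) = x³. *)

theory Defs
  imports "HOL-Analysis.Analysis"
begin

text \<open>
  The index set \<open>[n]\<close>, with its order, is an arbitrary finite linearly ordered type \<open>'n\<close>;
  thus \<open>n = CARD('n) \<ge> 1\<close>. Functions on \<open>I\<^sup>n\<close> are total functions on \<open>real ^ 'n\<close> of which only
  the values on \<open>I\<^sup>n\<close> are ever constrained.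
\<close>

definition cart_power :: "real set \<Rightarrow> (real ^ 'n) set" where
  "cart_power I = {x. \<forall>i. x $ i \<in> I}"

definition centered_at_0 :: "real set \<Rightarrow> bool" where
  "centered_at_0 I \<longleftrightarrow> (\<forall>x\<in>I. - x \<in> I)"

definition nonneg_part :: "real set \<Rightarrow> real set" where
  "nonneg_part I = I \<inter> {0..}"

definition nonpos_part :: "real set \<Rightarrow> real set" where
  "nonpos_part I = I \<inter> {..0}"

definition ind_vec :: "'n set \<Rightarrow> real ^ 'n" where
  "ind_vec A = (\<chi> i. if i \<in> A then 1 else 0)"

definition delta :: "(real ^ 'n \<Rightarrow> real) \<Rightarrow> 'n set \<Rightarrow> real \<Rightarrow> real" where
  "delta g A x = g (x *\<^sub>R ind_vec A)"

definition homogeneous_on :: "real set \<Rightarrow> (real \<Rightarrow> real) \<Rightarrow> bool" where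
  "homogeneous_on I u \<longleftrightarrow> (\<forall>x\<in>I. \<forall>c. c * x \<in> I \<longrightarrow> u (c * x) = c * u x)"

definition meet_vec :: "real ^ 'n \<Rightarrow> real \<Rightarrow> real ^ 'n" where
  "meet_vec x c = (\<chi> i. min (x $ i) c)"

definition join_vec :: "real ^ 'n \<Rightarrow> real \<Rightarrow> real ^ 'n" where
  "join_vec x c = (\<chi> i. max (x $ i) c)"

definition pos_vec :: "real ^ 'n \<Rightarrow> real ^ 'n" where
  "pos_vec x = join_vec x 0"

definition neg_vec :: "real ^ 'n \<Rightarrow> real ^ 'n" where
  "neg_vec x = pos_vec (- x)"

text \<open>\<open>upper_excess x c\<close> is \<open>[x]\<^sub>c\<close> and \<open>lower_excess x c\<close> is \<open>[x]\<^sup>c\<close>.\<close>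

definition upper_excess :: "real ^ 'n \<Rightarrow> real \<Rightarrow> real ^ 'n" where
  "upper_excess x c = x - meet_vec x c"

definition lower_excess :: "real ^ 'n \<Rightarrow> real \<Rightarrow> real ^ 'n" where
  "lower_excess x c = x - join_vec x c"

definition middle_value :: "real \<Rightarrow> real \<Rightarrow> real \<Rightarrow> real" where
  "middle_value a b c = sort [a, b, c] ! 1"

definition med_vec :: "real \<Rightarrow> real ^ 'n \<Rightarrow> real ^ 'n" where
  "med_vec c x = (\<chi> i. middle_value (- c) (x $ i) c)"

definition horizontally_median_additive_on ::
    "real set \<Rightarrow> (real ^ 'n \<Rightarrow> real) \<Rightarrow> bool" where
  "horizontally_median_additive_on I g \<longleftrightarrow>
     (\<forall>x\<in>cart_power I. \<forall>c\<in>nonneg_part I.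
        g x = g (med_vec c x) + g (upper_excess x c) + g (lower_excess x (- c)))"

definition weakly_regular_on :: "real set \<Rightarrow> (real \<Rightarrow> real) \<Rightarrow> bool" where
  "weakly_regular_on S u \<longleftrightarrow>
     (\<exists>x\<in>S. continuous (at x within S) u) \<or>
     (mono_on S u \<or> antimono_on S u) \<or>
     u \<in> borel_measurable (lebesgue_on S) \<or>
     (\<exists>T\<in>sets lebesgue. T \<subseteq> S \<and> emeasure lebesgue T > 0 \<and>
        (bdd_above (u ` T) \<or> bdd_below (u ` T)))"

text \<open>\<open>sorted_region \<sigma>\<close> is the cone \<open>x\<^bsub>\<sigma>(1)\<^esub> \<le> \<dots> \<le> x\<^bsub>\<sigma>(n)\<^esub>\<close>.\<close>

definition sorted_region :: "('n::{finite,linorder} \<Rightarrow> 'n) \<Rightarrow> (real ^ 'n::{finite,linorder}) set" where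
  "sorted_region \<sigma> = {x. mono (\<lambda>i. x $ \<sigma> i)}"

definition affine_map :: "('a::real_vector \<Rightarrow> 'b::real_vector) \<Rightarrow> bool" where
  "affine_map g \<longleftrightarrow> (\<exists>l b. linear l \<and> g = (\<lambda>x. l x + b))"

text \<open>
  A set function \<open>\<phi>\<close> on \<open>{0,1}\<^sup>n\<close> is given as a total function; only its values at vectors with
  all components in \<open>{0,1}\<close> matter, since these are the vertices below.
\<close>

definition is_lovasz_extension_of ::
    "(real ^ 'n::{finite,linorder} \<Rightarrow> real) \<Rightarrow> (real ^ 'n::_ \<Rightarrow> real) \<Rightarrow> bool" where
  "is_lovasz_extension_of \<phi> F \<longleftrightarrow>
     (\<forall>\<sigma>. \<sigma> permutes UNIV \<longrightarrow>
        (\<exists>g. affine_map g \<and>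
             (\<forall>v. v extreme_point_of (cbox 0 1 \<inter> sorted_region \<sigma>) \<longrightarrow> g v = \<phi> v) \<and>
             (\<forall>x\<in>sorted_region \<sigma>. F x = g x)))"

definition lovasz_extension ::
    "(real ^ 'n::{finite,linorder} \<Rightarrow> real) \<Rightarrow> real ^ 'n::_ \<Rightarrow> real" where
  "lovasz_extension \<phi> = (THE F. is_lovasz_extension_of \<phi> F)"

definition symmetric_lovasz_extension ::
    "(real ^ 'n::{finite,linorder} \<Rightarrow> real) \<Rightarrow> real ^ 'n::_ \<Rightarrow> real" where
  "symmetric_lovasz_extension \<phi> x =
     lovasz_extension \<phi> 0 + lovasz_extension \<phi> (pos_vec x) - lovasz_extension \<phi> (neg_vec x)"

definition is_symmetric_lovasz_extension_on ::
    "real set \<Rightarrow> (real ^ 'n::{finite,linorder} \<Rightarrow> real) \<Rightarrow> bool" where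
  "is_symmetric_lovasz_extension_on I f \<longleftrightarrow>
     (\<exists>\<phi>. \<forall>x\<in>cart_power I. f x = symmetric_lovasz_extension \<phi> x)"

subsection \<open>Well-definedness of the Lovasz extension\<close>

lemma extreme_point_iff_zero_one:
  fixes \<sigma> :: "'n::{finite,linorder} \<Rightarrow> 'n"
  assumes "\<sigma> permutes UNIV"
  shows "v extreme_point_of (cbox 0 1 \<inter> sorted_region \<sigma>) \<longleftrightarrow>
         v \<in> sorted_region \<sigma> \<and> (\<forall>i. v $ i \<in> {0, 1})"
proof
  assume e: "v extreme_point_of (cbox 0 1 \<inter> sorted_region \<sigma>)"
  then have v: "v \<in> cbox 0 1" "v \<in> sorted_region \<sigma>"
    by (auto simp: extreme_point_of_def)
  have v01: "0 \<le> v $ i" "v $ i \<le> 1" for i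
    using v(1) by (auto simp: mem_box_cart)
  have "v $ i \<in> {0, 1}" for i
  proof (rule ccontr)
    assume ni: "v $ i \<notin> {0, 1}"
    define t where "t = v $ i"
    have t: "0 < t" "t < 1"
      using v01[of i] ni by (auto simp: t_def less_le)
    define D where "D = insert t (insert (1 - t) ((\<lambda>j. \<bar>v $ j - t\<bar>) ` {j. v $ j \<noteq> t}))"
    define \<epsilon> where "\<epsilon> = Min D / 2"
    have D: "finite D" "D \<noteq> {}" "\<forall>d\<in>D. d > 0"
      using t by (auto simp: D_def)
    have eps: "\<epsilon> > 0" and eps_le: "\<And>d. d \<in> D \<Longrightarrow> \<epsilon> < d"
    proof -
      have "Min D > 0" using D by simp
      then show "\<epsilon> > 0" by (simp add: \<epsilon>_def)
      fix d assume "d \<in> D"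
      then have "Min D \<le> d" using D by simp
      then show "\<epsilon> < d" using \<open>Min D > 0\<close> by (simp add: \<epsilon>_def)
    qed
    define w where "w = (\<lambda>s::real. (\<chi> j. if v $ j = t then t + s else v $ j) :: real ^ 'n::_)"
    have w: "w s \<in> cbox 0 1 \<inter> sorted_region \<sigma>" if s: "\<bar>s\<bar> \<le> \<epsilon>" for s
    proof
      have "\<epsilon> < t" "\<epsilon> < 1 - t" using eps_le by (auto simp: D_def)
      then show "w s \<in> cbox 0 1" using v01 s by (auto simp: mem_box_cart w_def)
      have far: "\<epsilon> < \<bar>v $ j - t\<bar>" if "v $ j \<noteq> t" for j
        using eps_le that by (auto simp: D_def)
      have "w s $ \<sigma> a \<le> w s $ \<sigma> b" if "a \<le> b" for a b
      proof -
        have "v $ \<sigma> a \<le> v $ \<sigma> b"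
          using v(2) that by (auto simp: sorted_region_def mono_def)
        then show ?thesis using far[of "\<sigma> a"] far[of "\<sigma> b"] s by (auto simp: w_def)
      qed
      then show "w s \<in> sorted_region \<sigma>" by (auto simp: sorted_region_def mono_def)
    qed
    have "v = midpoint (w \<epsilon>) (w (- \<epsilon>))"
      by (auto simp: vec_eq_iff midpoint_def w_def)
    moreover have "w \<epsilon> \<noteq> w (- \<epsilon>)"
    proof
      assume "w \<epsilon> = w (- \<epsilon>)"
      then have "w \<epsilon> $ i = w (- \<epsilon>) $ i" by simp
      then show False using eps by (simp add: w_def t_def)
    qed
    ultimately have "v \<in> open_segment (w \<epsilon>) (w (- \<epsilon>))"
      by (simp add: midpoint_in_open_segment)
    then show False
      using e w[of \<epsilon>] w[of "- \<epsilon>"] eps by (auto simp: extreme_point_of_def)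
  qed
  then show "v \<in> sorted_region \<sigma> \<and> (\<forall>i. v $ i \<in> {0, 1})" using v by blast
next
  assume v: "v \<in> sorted_region \<sigma> \<and> (\<forall>i. v $ i \<in> {0, 1})"
  have vc: "v \<in> cbox 0 1"
    unfolding mem_box_cart
  proof
    fix i show "(0::real^ 'n::_) $ i \<le> v $ i \<and> v $ i \<le> (1::real^ 'n::_) $ i"
      using v[THEN conjunct2, rule_format, of i] by auto
  qed
  have "v \<notin> open_segment a b" if a: "a \<in> cbox 0 1" and b: "b \<in> cbox 0 1" for a b
  proof
    assume "v \<in> open_segment a b"
    then obtain u where u: "a \<noteq> b" "0 < u" "u < 1" "v = (1 - u) *\<^sub>R a + u *\<^sub>R b"
      by (auto simp: in_segment)
    have "a $ i = b $ i" for i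
    proof -
      have *: "0 \<le> a $ i" "a $ i \<le> 1" "0 \<le> b $ i" "b $ i \<le> 1"
        using a b by (auto simp: mem_box_cart)
      have vi: "v $ i = (1 - u) * a $ i + u * b $ i" using u(4) by simp
      have "v $ i = 0 \<or> v $ i = 1" using v by auto
      then show ?thesis
      proof
        assume "v $ i = 0"
        moreover have "(1 - u) * a $ i \<ge> 0" "u * b $ i \<ge> 0" using * u by auto
        ultimately have "(1 - u) * a $ i = 0" "u * b $ i = 0" using vi by linarith+
        then show ?thesis using u by simp
      next
        assume "v $ i = 1"
        then have "(1 - u) * (1 - a $ i) + u * (1 - b $ i) = 0"
          using vi by (simp add: algebra_simps)
        moreover have "(1 - u) * (1 - a $ i) \<ge> 0" "u * (1 - b $ i) \<ge> 0" using * u by auto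
        ultimately have "(1 - u) * (1 - a $ i) = 0" "u * (1 - b $ i) = 0" by linarith+
        then show ?thesis using u by simp
      qed
    qed
    then show False using u(1) by (simp add: vec_eq_iff)
  qed
  then show "v extreme_point_of (cbox 0 1 \<inter> sorted_region \<sigma>)"
    using v vc by (auto simp: extreme_point_of_def)
qed

lemma ex_sorted_region:
  fixes x :: "real ^ 'n::{finite,linorder}"
  shows "\<exists>\<sigma>. \<sigma> permutes UNIV \<and> x \<in> sorted_region \<sigma>"
proof -
  define ys where "ys = sort_key (\<lambda>i. x $ i) (sorted_list_of_set (UNIV :: 'n set))"
  define r where "r = (\<lambda>i::'n. card {j. j < i})"
  have ys: "distinct ys" "length ys = CARD('n)" "sorted (map (\<lambda>i. x $ i) ys)"
    by (simp_all add: ys_def)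
  have r_less: "r i < r j" if "i < j" for i j
    unfolding r_def using that by (intro psubset_card_mono) auto
  have r_bound: "r i < CARD('n)" for i
    unfolding r_def by (intro psubset_card_mono) auto
  define \<sigma> where "\<sigma> = (\<lambda>i. ys ! r i)"
  have "inj \<sigma>"
  proof (rule injI)
    fix i j assume "\<sigma> i = \<sigma> j"
    then have "r i = r j" using ys r_bound by (simp add: \<sigma>_def nth_eq_iff_index_eq)
    then show "i = j" using r_less by (metis less_irrefl linorder_neqE)
  qed
  then have "bij \<sigma>" by (simp add: bij_def finite_UNIV_inj_surj)
  then have "\<sigma> permutes UNIV" by (auto intro: bij_imp_permutes)
  moreover have "x $ \<sigma> i \<le> x $ \<sigma> j" if "i \<le> j" for i j
  proof -
    have "r i \<le> r j" using r_less that by (cases "i = j") (auto simp: le_less)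
    then show ?thesis
      using sorted_nth_mono[OF ys(3), of "r i" "r j"] ys(2) r_bound by (simp add: \<sigma>_def)
  qed
  ultimately show ?thesis by (auto simp: sorted_region_def mono_def)
qed

lemma affine_map_eq_of_vertices:
  fixes \<sigma> :: "'n::{finite,linorder} \<Rightarrow> 'n" and g h :: "real ^ 'n::_ \<Rightarrow> real"
  assumes \<sigma>: "\<sigma> permutes UNIV" and g: "affine_map g" and h: "affine_map h"
    and eq: "\<And>v. v extreme_point_of (cbox 0 1 \<inter> sorted_region \<sigma>) \<Longrightarrow> g v = h v"
  shows "g = h"
proof -
  obtain l b where l: "linear l" "g = (\<lambda>x. l x + b)" using g by (auto simp: affine_map_def)
  obtain m c where m: "linear m" "h = (\<lambda>x. m x + c)" using h by (auto simp: affine_map_def)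
  have \<sigma>_inj: "\<sigma> i = \<sigma> j \<longleftrightarrow> i = j" for i j
    using permutes_inj[OF \<sigma>] by (auto simp: inj_def)
  have up: "g (ind_vec (\<sigma> ` U)) = h (ind_vec (\<sigma> ` U))" if U: "\<And>i j. i \<in> U \<Longrightarrow> i \<le> j \<Longrightarrow> j \<in> U" for U
  proof (rule eq, subst extreme_point_iff_zero_one[OF \<sigma>], intro conjI)
    show "ind_vec (\<sigma> ` U) \<in> sorted_region \<sigma>"
      using U by (auto simp: sorted_region_def mono_def ind_vec_def image_iff \<sigma>_inj)
    show "\<forall>i. ind_vec (\<sigma> ` U) $ i \<in> {0, 1}" by (auto simp: ind_vec_def)
  qed
  have z: "ind_vec {} = (0 :: real ^ 'n::_)" by (simp add: ind_vec_def vec_eq_iff)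
  have bc: "b = c"
    using up[of "{}"] z l m by (simp add: linear_0)
  have ax: "l (axis (\<sigma> k) 1) = m (axis (\<sigma> k) 1)" for k
  proof -
    have d: "axis (\<sigma> k) 1 = ind_vec (\<sigma> ` {k..}) - (ind_vec (\<sigma> ` {k<..}) :: real ^ 'n::_)"
    proof -
      have "axis (\<sigma> k) 1 $ \<sigma> i = (ind_vec (\<sigma> ` {k..}) - (ind_vec (\<sigma> ` {k<..}) :: real ^ 'n::_)) $ \<sigma> i" for i
        by (auto simp: axis_def ind_vec_def image_iff \<sigma>_inj)
      moreover have "\<exists>i. j = \<sigma> i" for j using permutes_surj[OF \<sigma>] by (auto simp: surj_def)
      ultimately show ?thesis unfolding vec_eq_iff by metis
    qed
    have "l (ind_vec (\<sigma> ` {k..})) = m (ind_vec (\<sigma> ` {k..}))"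
      using up[of "{k..}"] bc l m by auto
    moreover have "l (ind_vec (\<sigma> ` {k<..})) = m (ind_vec (\<sigma> ` {k<..}))"
      using up[of "{k<..}"] bc l m by auto
    ultimately show ?thesis using l m by (simp add: d linear_diff)
  qed
  have "l x = m x" for x
  proof (rule linear_eq_on_span[OF l(1) m(1), of Basis])
    fix y :: "real ^ 'n::_" assume "y \<in> Basis"
    then obtain j where "y = axis j 1" by (auto simp: Basis_vec_def)
    moreover obtain k where "j = \<sigma> k" using permutes_surj[OF \<sigma>] by (auto simp: surj_def)
    ultimately show "l y = m y" using ax by simp
  qed simp
  then show ?thesis using l m bc by auto
qed

text \<open>
  Existence: with \<open>m\<close> the Moebius transform of \<open>\<phi>\<close>, the function
  \<open>m {} + (\<Sum>A\<noteq>{}. m A * Min ((\<lambda>i. x $ i) ` A))\<close> is affine on each cone.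
\<close>

lemma ex_lovasz_extension:
  fixes \<phi> :: "real ^ 'n::{finite,linorder} \<Rightarrow> real"
  shows "\<exists>F. is_lovasz_extension_of \<phi> F"
proof -
  define p where "p = (\<lambda>A :: 'n set. \<phi> (ind_vec A))"
  define q where "q = (\<lambda>S :: 'n set. \<Sum>T\<in>Pow S. (-1) ^ card T * p T)"
  define m where "m = (\<lambda>S :: 'n set. (-1) ^ card S * q S)"
  have mob: "p S = (\<Sum>T\<in>Pow S. m T)" for S
    unfolding m_def by (rule inclusion_exclusion_symmetric[of q p]) (simp_all add: q_def)
  define F where "F = (\<lambda>x :: real ^ 'n::_. m {} + (\<Sum>A\<in>UNIV - {{}}. m A * Min ((\<lambda>i. x $ i) ` A)))"
  have F01: "F v = \<phi> v" if "\<forall>i. v $ i \<in> {0, 1}" for v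
  proof -
    define B where "B = {i. v $ i = 1}"
    have vB: "v = ind_vec B" using that by (auto simp: vec_eq_iff ind_vec_def B_def)
    have mn: "Min ((\<lambda>i. v $ i) ` A) = (if A \<subseteq> B then 1 else 0)" if "A \<noteq> {}" for A
    proof (cases "A \<subseteq> B")
      case True
      then have "(\<lambda>i. v $ i) ` A = {1}" using that by (auto simp: B_def)
      then show ?thesis using True by simp
    next
      case False
      then obtain i where i: "i \<in> A" "v $ i = 0" using \<open>\<forall>i. v $ i \<in> {0, 1}\<close> by (auto simp: B_def)
      have "Min ((\<lambda>i. v $ i) ` A) = 0"
      proof (rule Min_eqI)
        fix y assume "y \<in> (\<lambda>i. v $ i) ` A"
        then obtain j where "y = v $ j" by auto
        then show "0 \<le> y" using \<open>\<forall>i. v $ i \<in> {0, 1}\<close>[rule_format, of j] by auto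
      qed (use i in \<open>auto simp: image_iff intro!: bexI[of _ i]\<close>)
      then show ?thesis using False by simp
    qed
    have "F v = m {} + (\<Sum>A\<in>UNIV - {{}}. if A \<subseteq> B then m A else 0)"
      unfolding F_def by (intro arg_cong2[where f = "(+)"] sum.cong) (auto simp: mn)
    also have "\<dots> = (\<Sum>A\<in>UNIV. if A \<subseteq> B then m A else 0)"
      by (subst sum.remove[of _ "{}"]) auto
    also have "\<dots> = (\<Sum>A\<in>Pow B. m A)"
      by (simp add: sum.If_cases Pow_def)
    finally show ?thesis using mob[of B] by (simp add: p_def vB)
  qed
  have "is_lovasz_extension_of \<phi> F"
    unfolding is_lovasz_extension_of_def
  proof (intro allI impI)
    fix \<sigma> :: "'n \<Rightarrow> 'n" assume \<sigma>: "\<sigma> permutes UNIV"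
    define k where "k = (\<lambda>A. \<sigma> (Min {j. \<sigma> j \<in> A}))"
    define g where "g = (\<lambda>x :: real ^ 'n::_. (\<Sum>A\<in>UNIV - {{}}. m A * x $ k A) + m {})"
    have "linear (\<lambda>x :: real ^ 'n::_. \<Sum>A\<in>UNIV - {{}}. m A * x $ k A)"
      by (rule linearI) (simp_all add: algebra_simps sum.distrib sum_distrib_left)
    then have aff: "affine_map g" by (auto simp: affine_map_def g_def)
    have Fg: "F x = g x" if x: "x \<in> sorted_region \<sigma>" for x
    proof -
      have "Min ((\<lambda>i. x $ i) ` A) = x $ k A" if "A \<noteq> {}" for A
      proof (rule Min_eqI)
        have ne: "{j. \<sigma> j \<in> A} \<noteq> {}"
          using that permutes_surj[OF \<sigma>] by (auto simp: surj_def) metis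
        then have "Min {j. \<sigma> j \<in> A} \<in> {j. \<sigma> j \<in> A}" by (intro Min_in) auto
        then show "x $ k A \<in> (\<lambda>i. x $ i) ` A" by (simp add: k_def)
        fix y assume "y \<in> (\<lambda>i. x $ i) ` A"
        then obtain i where i: "i \<in> A" "y = x $ i" by auto
        obtain j where j: "i = \<sigma> j" using permutes_surj[OF \<sigma>] by (auto simp: surj_def)
        have "Min {j. \<sigma> j \<in> A} \<le> j" using i j by (intro Min_le) auto
        then show "x $ k A \<le> y"
          using x i j by (auto simp: k_def sorted_region_def mono_def)
      qed simp
      then show ?thesis by (simp add: F_def g_def)
    qed
    have "g v = \<phi> v" if "v extreme_point_of (cbox 0 1 \<inter> sorted_region \<sigma>)" for v
      using that Fg[of v] F01[of v] by (simp add: extreme_point_iff_zero_one[OF \<sigma>])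
    then show "\<exists>g. affine_map g \<and>
             (\<forall>v. v extreme_point_of (cbox 0 1 \<inter> sorted_region \<sigma>) \<longrightarrow> g v = \<phi> v) \<and>
             (\<forall>x\<in>sorted_region \<sigma>. F x = g x)"
      using aff Fg by blast
  qed
  then show ?thesis by blast
qed

theorem ex1_lovasz_extension:
  fixes \<phi> :: "real ^ 'n::{finite,linorder} \<Rightarrow> real"
  shows "\<exists>!F. is_lovasz_extension_of \<phi> F"
proof (rule ex_ex1I[OF ex_lovasz_extension])
  fix F G assume F: "is_lovasz_extension_of \<phi> F" and G: "is_lovasz_extension_of \<phi> G"
  show "F = G"
  proof
    fix x :: "real ^ 'n::_"
    obtain \<sigma> :: "'n \<Rightarrow> 'n" where \<sigma>: "\<sigma> permutes UNIV" and x: "x \<in> sorted_region \<sigma>"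
      using ex_sorted_region by blast
    let ?P = "cbox 0 1 \<inter> sorted_region \<sigma>"
    obtain g where g: "affine_map g" "\<forall>v. v extreme_point_of ?P \<longrightarrow> g v = \<phi> v" "F x = g x"
      using F \<sigma> x unfolding is_lovasz_extension_of_def by blast
    obtain h where h: "affine_map h" "\<forall>v. v extreme_point_of ?P \<longrightarrow> h v = \<phi> v" "G x = h x"
      using G \<sigma> x unfolding is_lovasz_extension_of_def by blast
    have "g = h"
      by (rule affine_map_eq_of_vertices[OF \<sigma> g(1) h(1)]) (use g h in auto)
    then show "F x = G x" using g h by simp
  qed
qed

lemma is_lovasz_extension_of_lovasz_extension:
  "is_lovasz_extension_of \<phi> (lovasz_extension \<phi>)"
  unfolding lovasz_extension_def by (rule theI'[OF ex1_lovasz_extension])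

end

theory Submission
  imports Defs
begin

text \<open>
  Cutting a vector at the levels \<open>c\<close> and \<open>-c\<close> splits it into a middle part and two excesses, and
  horizontal median-additivity says that \<open>f\<^sub>0\<close> is additive for all these splittings. This has two
  consequences.

  First, a multiple of an indicator \<open>1\<^sub>A\<close> splits into multiples of \<open>1\<^sub>A\<close>, so each section
  \<open>\<delta>\<^sup>A\<close> satisfies Cauchy's equation \<open>u (a + b) = u a + u b\<close> on either half of \<open>I\<close>. Each of the regularity
  alternatives bounds \<open>\<delta>\<^sup>A\<close> from one side on a set \<open>T\<close> of positive measure
  (\<open>weakly_regular_imp_one_sided_bounded\<close>). The midpoints of pairs from \<open>T\<close> cover an interval
  (\<open>midpoints_contain_interval\<close>), so the bound holds on an interval, and an additive function bounded from
  one side on an interval is linear (\<open>additive_bdd_above_linear\<close>). The section is thus linear on each half of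
  \<open>I\<close>, and the condition \<open>\<delta>\<^sup>A (-1) = - \<delta>\<^sup>A 1\<close> makes the two slopes equal, which is homogeneity
  (\<open>median_additive_regular_iff_homogeneous\<close>).

  Secondly, repeated cutting reduces every vector to multiples of indicators, so a median-additive
  function is determined by its sections (\<open>median_additive_eq_if_delta_eq\<close>). A symmetric Lovasz extension,
  less its value at \<open>0\<close>, is median-additive, because a Lovasz extension is affine on each sorted cone and
  the parts of a nonnegative vector lie in the same cone as the vector; its sections are homogeneous.
  Conversely, if \<open>f\<^sub>0\<close> is median-additive with homogeneous sections, then the symmetric Lovasz
  extension of the restriction of \<open>f\<close> to \<open>{0,1}\<^sup>n\<close>, less its value at \<open>0\<close>, has the same sections as
  \<open>f\<^sub>0\<close>, and the two functions agree.
\<close>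

section \<open>Midpoints of sets of positive measure\<close>

lemma sets_lebesgue_reflect:
  fixes S :: "'a::euclidean_space set"
  assumes "S \<in> sets lebesgue"
  shows "uminus ` S \<in> sets lebesgue"
proof -
  have "uminus ` S = scaleR (-1) -` S \<inter> space lebesgue"
    by (force simp: image_iff)
  then show ?thesis
    using measurable_sets[OF lebesgue_measurable_scaling[of "-1"] assms] by simp
qed

text \<open>
  A weak form of the Lebesgue density theorem. It comes from a cover of \<open>S\<close> by countably many
  non-overlapping intervals whose total length is close to the measure of \<open>S\<close>; the average density
  of \<open>S\<close> in these intervals is then close to \<open>1\<close>, and some interval reaches the average.
\<close>

lemma exists_interval_of_high_density:
  fixes S :: "real set"
  assumes S: "S \<in> lmeasurable" and bdd: "bounded S" and pos: "measure lebesgue S > 0"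
  obtains a b where "a < b" "measure lebesgue (S \<inter> {a..b}) > 3 / 4 * (b - a)"
proof -
  let ?\<mu> = "measure (lebesgue :: real measure)"
  obtain c where c: "S \<subseteq> cbox (-c) c"
    using bounded_subset_cbox_symmetric[OF bdd] by blast
  obtain \<D> where \<D>: "countable \<D>"
    and boxes: "\<And>K. K \<in> \<D> \<Longrightarrow> K \<subseteq> cbox (-c) c \<and> K \<noteq> {} \<and> (\<exists>a b. K = cbox a b)"
    and disj: "pairwise (\<lambda>A B. interior A \<inter> interior B = {}) \<D>"
    and nonempty: "\<And>K. \<lbrakk>K \<in> \<D>; box (-c) c \<noteq> {}\<rbrakk> \<Longrightarrow> interior K \<noteq> {}"
    and cover: "S \<subseteq> \<Union>\<D>" and union: "\<Union>\<D> \<in> lmeasurable"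
    and small: "?\<mu> (\<Union>\<D>) \<le> ?\<mu> S + ?\<mu> S / 4"
  proof (rule measurable_outer_intervals_bounded[OF S c, of "?\<mu> S / 4"])
    show "?\<mu> S / 4 > 0" using pos by simp
  qed (rule that; assumption)
  have box: "box (-c) c \<noteq> {}"
  proof
    assume "box (-c) c = {}"
    then have "?\<mu> (cbox (-c) c) = 0" by (simp add: content_eq_0_interior)
    moreover have "?\<mu> S \<le> ?\<mu> (cbox (-c) c)"
      using c S by (intro measure_mono_fmeasurable) auto
    ultimately show False using pos by simp
  qed
  have meas: "K \<in> lmeasurable" if "K \<in> \<D>" for K
    using boxes[OF that] by auto
  have neg: "negligible (K \<inter> L)" if KL: "K \<in> \<D>" "L \<in> \<D>" "K \<noteq> L" for K L
  proof -
    have "interior (K \<inter> L) = {}" using disj KL by (simp add: pairwise_def)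
    moreover obtain a b p q where "K = cbox a b" "L = cbox p q"
      using boxes[OF KL(1)] boxes[OF KL(2)] by blast
    then have uv: "K \<inter> L = cbox (max a p) (min b q)" by simp
    ultimately have "box (max a p) (min b q) = {}" by (metis interior_cbox)
    then show ?thesis unfolding uv negligible_interval(1) .
  qed
  \<comment> \<open>Otherwise \<open>S\<close> would have at most \<open>3/4\<close> of the measure of a cover that exceeds \<open>S\<close> by a factor
    of at most \<open>5/4\<close>, and \<open>3/4 * 5/4 = 15/16 < 1\<close>.\<close>
  have "\<exists>K\<in>\<D>. ?\<mu> (S \<inter> K) > 3 / 4 * ?\<mu> K"
  proof (rule ccontr)
    assume "\<not> ?thesis"
    then have sparse: "?\<mu> (S \<inter> K) \<le> 3 / 4 * ?\<mu> K" if "K \<in> \<D>" for K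
      using that by force
    have fin: "?\<mu> (\<Union>K\<in>\<F>. S \<inter> K) \<le> 15 / 16 * ?\<mu> S" if \<F>: "finite \<F>" "\<F> \<subseteq> \<D>" for \<F>
    proof -
      have "?\<mu> (\<Union>K\<in>\<F>. S \<inter> K) \<le> (\<Sum>K\<in>\<F>. ?\<mu> (S \<inter> K))"
        using \<F> S meas by (intro measure_UNION_le) (auto intro!: fmeasurableD)
      also have "\<dots> \<le> (\<Sum>K\<in>\<F>. 3 / 4 * ?\<mu> K)"
        using \<F> sparse by (intro sum_mono) auto
      also have "\<dots> = 3 / 4 * ?\<mu> (\<Union>K\<in>\<F>. K)"
        using \<F> meas neg
        by (subst measure_negligible_finite_Union_image)
           (auto simp: sum_distrib_left pairwise_def subset_iff)
      also have "?\<mu> (\<Union>K\<in>\<F>. K) \<le> ?\<mu> (\<Union>\<D>)"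
        using \<F> meas union by (intro measure_mono_fmeasurable) (auto intro!: fmeasurableD sets.finite_UN)
      finally show ?thesis using small by simp
    qed
    have "\<D> \<noteq> {}" using cover pos by auto
    then have range: "range (from_nat_into \<D>) = \<D>" using \<D> by (rule range_from_nat_into)
    then have "S = (\<Union>i. S \<inter> from_nat_into \<D> i)" using cover by auto
    moreover have "?\<mu> (\<Union>i. S \<inter> from_nat_into \<D> i) \<le> 15 / 16 * ?\<mu> S"
    proof (rule measure_countable_Union_le)
      fix n
      show "S \<inter> from_nat_into \<D> n \<in> lmeasurable"
        using S meas range by (intro fmeasurable.Int) auto
      show "?\<mu> (\<Union>i\<le>n. S \<inter> from_nat_into \<D> i) \<le> 15 / 16 * ?\<mu> S"
        using fin[of "from_nat_into \<D> ` {..n}"] range by auto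
    qed
    ultimately show False using pos by simp
  qed
  then obtain K where K: "K \<in> \<D>" "?\<mu> (S \<inter> K) > 3 / 4 * ?\<mu> K" by blast
  obtain a b where ab: "K = cbox a b" using boxes[OF K(1)] by blast
  have "a < b" using nonempty[OF K(1) box] by (simp add: ab)
  then show thesis using that K by (simp add: ab)
qed

text \<open>
  A relative of Steinhaus' theorem on \<open>S - S\<close>. Sums \<open>S + S\<close> rather than differences are what
  one-sided bounds call for, because an additive function bounded above on \<open>S\<close> is bounded above on
  \<open>S + S\<close> but need not be so on \<open>S - S\<close>. Midpoints have the further advantage that they stay in any interval
  containing \<open>S\<close>. In an interval where \<open>S\<close> has density above \<open>3/4\<close>, the set \<open>S\<close> meets each of its mirror
  images about points close to the centre, and a common point \<open>x = 2z - y\<close> exhibits \<open>z\<close> as a midpoint.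
\<close>

lemma midpoints_contain_interval:
  fixes S :: "real set"
  assumes S: "S \<in> sets lebesgue" and pos: "emeasure lebesgue S > 0"
  obtains p q where "p < q" "\<And>z. z \<in> {p..q} \<Longrightarrow> \<exists>x\<in>S. \<exists>y\<in>S. z = (x + y) / 2"
proof -
  let ?\<mu> = "measure (lebesgue :: real measure)"
  \<comment> \<open>A bounded part of \<open>S\<close> of positive measure, so that all measures below are finite.\<close>
  have "\<exists>n::nat. emeasure lebesgue (S \<inter> {- real n..real n}) > 0"
  proof (rule ccontr)
    assume "\<not> ?thesis"
    then have "S \<inter> {- real n..real n} \<in> null_sets lebesgue" for n :: nat
      using S by (auto simp: null_sets_def)
    then have "(\<Union>n. S \<inter> {- real n..real n}) \<in> null_sets lebesgue" by blast
    moreover have "(\<Union>n. S \<inter> {- real n..real n}) = S"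
    proof -
      have "\<exists>n. - real n \<le> x \<and> x \<le> real n" for x
        using real_arch_simple[of "\<bar>x\<bar>"] by (meson abs_le_iff minus_le_iff)
      then show ?thesis by auto
    qed
    ultimately show False using pos by auto
  qed
  then obtain n :: nat where n: "emeasure lebesgue (S \<inter> {- real n..real n}) > 0" by blast
  define B where "B = S \<inter> {- real n..real n}"
  have "bounded B" unfolding B_def by (rule bounded_subset[OF bounded_closed_interval]) blast
  moreover have "B \<in> sets lebesgue" unfolding B_def using S by (rule sets.Int) simp
  ultimately have B: "B \<in> lmeasurable" "bounded B"
    using bounded_set_imp_lmeasurable by auto
  have "?\<mu> B > 0"
    using n B(1) unfolding B_def[symmetric] by (simp add: emeasure_eq_measure2)
  then obtain a b where ab: "a < b" "?\<mu> (B \<inter> {a..b}) > 3 / 4 * (b - a)"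
    using exists_interval_of_high_density B by blast
  define P where "P = B \<inter> {a..b}"
  define h where "h = (b - a) / 4"
  have P: "P \<in> lmeasurable" "P \<subseteq> {a..b}" "P \<subseteq> S"
    using B by (auto simp: P_def B_def)
  have h: "h > 0" using ab by (simp add: h_def)
  have meet: "\<exists>x\<in>P. \<exists>y\<in>P. a + b + s = x + y" if s: "\<bar>s\<bar> \<le> h" for s
  proof (rule ccontr)
    assume none: "\<not> ?thesis"
    \<comment> \<open>\<open>P\<close> and its mirror image \<open>a + b + s - P\<close> are too large to be disjoint: together they
      measure more than \<open>3/2 * (b - a)\<close>, the length of an interval containing both.\<close>
    define Q where "Q = (\<lambda>y. (-1) *\<^sub>R y + (a + b + s)) ` P"
    have Qm: "?\<mu> Q = ?\<mu> P"
      unfolding Q_def using measure_lebesgue_affine[of "-1" "a + b + s" P] by simp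
    have "Q = (+) (a + b + s) ` uminus ` P"
      by (simp add: Q_def image_image)
    then have "Q \<in> sets lebesgue"
      using P by (simp add: lebesgue_sets_translation sets_lebesgue_reflect fmeasurableD)
    moreover have "Q \<subseteq> cbox (a + s) (b + s)" using P by (auto simp: Q_def)
    ultimately have Q: "Q \<in> lmeasurable"
      by (meson bounded_cbox bounded_subset bounded_set_imp_lmeasurable)
    have "P \<inter> Q = {}" using none by (force simp: Q_def)
    then have "?\<mu> P + ?\<mu> Q = ?\<mu> (P \<union> Q)" using P Q by (simp add: measure_Un3)
    also have "\<dots> \<le> ?\<mu> {a - h..b + h}"
    proof (intro measure_mono_fmeasurable)
      have sub: "x \<in> {a..b}" if "x \<in> P" for x using P that by blast
      show "P \<union> Q \<subseteq> {a - h..b + h}"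
      proof
        fix z assume "z \<in> P \<union> Q"
        then consider "z \<in> P" | y where "y \<in> P" "z = a + b + s - y" by (auto simp: Q_def)
        then show "z \<in> {a - h..b + h}"
        proof cases
          case 1
          then show ?thesis using sub[of z] h by simp
        next
          case 2
          then show ?thesis using sub[of y] s unfolding abs_le_iff by simp
        qed
      qed
    qed (use P Q in auto)
    also have "\<dots> = 3 / 2 * (b - a)" using ab by (simp add: h_def field_simps)
    finally show False using ab Qm by (simp add: P_def)
  qed
  show thesis
  proof
    show "(a + b - h) / 2 < (a + b + h) / 2" using h by simp
    fix z assume "z \<in> {(a + b - h) / 2..(a + b + h) / 2}"
    then have "(a + b - h) / 2 \<le> z" "z \<le> (a + b + h) / 2" by auto
    then have "\<bar>2 * z - (a + b)\<bar> \<le> h" unfolding abs_le_iff by simp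
    from meet[OF this] obtain x y where "x \<in> P" "y \<in> P" "z = (x + y) / 2" by force
    then show "\<exists>x\<in>S. \<exists>y\<in>S. z = (x + y) / 2" using P by blast
  qed
qed

section \<open>Cauchy's functional equation on an interval\<close>

lemma restricted_additive_multiple:
  fixes u :: "real \<Rightarrow> real"
  assumes J: "is_interval J" "0 \<in> J"
    and add: "\<And>a b. 0 \<le> a \<Longrightarrow> 0 \<le> b \<Longrightarrow> a + b \<in> J \<Longrightarrow> u (a + b) = u a + u b"
    and x: "0 \<le> x" "real n * x \<in> J"
  shows "u (real n * x) = real n * u x"
  using x(2)
proof (induction n)
  case 0
  then show ?case using add[of 0 0] J by simp
next
  case (Suc n)
  have "real n * x \<in> J"
    by (rule mem_is_interval_1_I[OF J(1,2) Suc.prems]) (use x(1) in \<open>auto simp: algebra_simps\<close>)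
  then show ?case using Suc add[of "real n * x" x] x(1) by (simp add: algebra_simps)
qed

text \<open>
  From \<open>v 1 = 0\<close> additivity gives \<open>v (1 / m) = 0\<close> for all \<open>m\<close>, so \<open>v\<close> has arbitrarily small periods:
  the bound near \<open>0\<close> extends to \<open>[0, 1]\<close>, and every value of \<open>v\<close> is taken at points \<open>r < 1 / m\<close>. There
  \<open>v (m * r) = m * v r\<close>, and a bound on these for all \<open>m\<close> leaves only the value \<open>0\<close>.
\<close>

lemma bounded_additive_vanishes:
  fixes v :: "real \<Rightarrow> real"
  assumes J: "is_interval J" "{0..1} \<subseteq> J"
    and add: "\<And>a b. 0 \<le> a \<Longrightarrow> 0 \<le> b \<Longrightarrow> a + b \<in> J \<Longrightarrow> v (a + b) = v a + v b"
    and v1: "v 1 = 0"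
    and bounded: "d > 0" "\<And>t. 0 \<le> t \<Longrightarrow> t \<le> d \<Longrightarrow> v t \<le> M"
    and x: "x \<in> J" "0 \<le> x"
  shows "v x = 0"
proof -
  have zero: "0 \<in> J" using J by auto
  have down: "y \<in> J" if "z \<in> J" "0 \<le> y" "y \<le> z" for y z
    using mem_is_interval_1_I[OF J(1) zero that] .
  note multiple = restricted_additive_multiple[OF J(1) zero add]
  have frac: "v (1 / real m) = 0" if "m > 0" for m :: nat
  proof -
    have "1 \<in> J" using J by auto
    then show ?thesis using multiple[of "1 / real m" m] that v1 by simp
  qed
  \<comment> \<open>\<open>v\<close> is zero at every \<open>k / m\<close>, hence takes the same value at \<open>x\<close> and at its remainder
    modulo \<open>1 / m\<close>.\<close>
  have reduce: "\<exists>r. 0 \<le> r \<and> r < 1 / real m \<and> v x = v r" if x: "x \<in> J" "0 \<le> x" and m: "m > 0"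
    for x :: real and m :: nat
  proof -
    define k where "k = nat \<lfloor>real m * x\<rfloor>"
    define r where "r = x - real k * (1 / real m)"
    have k: "real k \<le> real m * x" "real m * x < real k + 1"
      using x by (auto simp: k_def) 
    have "r = (real m * x - real k) / real m" using m by (simp add: r_def diff_divide_distrib)
    then have r: "0 \<le> r" "r < 1 / real m"
      using k m by (simp_all add: divide_strict_right_mono)
    have "real k * (1 / real m) \<in> J"
      by (rule down[OF x(1)]) (use k m in \<open>auto simp: field_simps\<close>)
    then have "v (real k * (1 / real m)) = 0" using multiple[of "1 / real m" k] frac[OF m] by simp
    moreover have "v x = v (real k * (1 / real m)) + v r"
      using add[of "real k * (1 / real m)" r] r x by (simp add: r_def)
    ultimately show ?thesis using r by auto
  qed
  obtain N :: nat where N: "N > 0" "1 / real N < d"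
    using reals_Archimedean[OF bounded(1)] by (metis inverse_eq_divide zero_less_Suc)
  \<comment> \<open>On \<open>[0, 1/N]\<close> the upper bound is also a lower bound, since \<open>v (1/N - r) = - v r\<close>.\<close>
  have abs_le: "\<bar>v t\<bar> \<le> M" if t: "0 \<le> t" "t \<le> 1" for t
  proof -
    obtain r where r: "0 \<le> r" "r < 1 / real N" "v t = v r"
      using reduce[of t N] subsetD[OF J(2), of t] t N by auto
    have "1 / real N \<in> J" using subsetD[OF J(2), of "1 / real N"] N by simp
    then have "v r = - v (1 / real N - r)"
      using add[of r "1 / real N - r"] frac[OF N(1)] r by simp
    moreover have "v r \<le> M" "v (1 / real N - r) \<le> M" using bounded(2) r N by auto
    ultimately show ?thesis using r(3) by linarith
  qed
  \<comment> \<open>With \<open>r < 1/m\<close> the multiple \<open>m * r\<close> is still in \<open>[0, 1]\<close>, where \<open>v\<close> is bounded by \<open>M\<close>.\<close>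
  have small: "real m * \<bar>v x\<bar> \<le> M" if m: "m > 0" for m :: nat
  proof -
    obtain r where r: "0 \<le> r" "r < 1 / real m" "v x = v r"
      using reduce[OF x m] by auto
    have mr: "0 \<le> real m * r" "real m * r \<le> 1" using r m by (auto simp: field_simps)
    then have "v (real m * r) = real m * v x"
      using multiple[of r m] subsetD[OF J(2), of "real m * r"] r by simp
    then show ?thesis using abs_le[OF mr] by (simp add: abs_mult)
  qed
  show ?thesis
  proof (rule ccontr)
    assume "v x \<noteq> 0"
    then obtain m :: nat where "M < real m * \<bar>v x\<bar>"
      using reals_Archimedean3[of "\<bar>v x\<bar>"] by auto
    moreover have "0 \<le> M" using abs_le[of 0] by simp
    ultimately show False using small[of m] by (cases "m = 0") auto
  qed
qed

text \<open>
  Ostrowski's theorem for Cauchy's equation on an interval starting at \<open>0\<close>. As \<open>u\<close> preserves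
  midpoints, the bound on \<open>T\<close> carries over to an interval \<open>[p, q]\<close>, and by translation to \<open>[0, q - p]\<close>; the
  difference of \<open>u\<close> and the linear function with the same value at \<open>1\<close> is then of the kind shown to vanish.
\<close>

lemma additive_bdd_above_linear:
  fixes u :: "real \<Rightarrow> real"
  assumes J: "is_interval J" "{0..1} \<subseteq> J" "J \<subseteq> {0..}"
    and add: "\<And>a b. 0 \<le> a \<Longrightarrow> 0 \<le> b \<Longrightarrow> a + b \<in> J \<Longrightarrow> u (a + b) = u a + u b"
    and T: "T \<in> sets lebesgue" "emeasure lebesgue T > 0" "T \<subseteq> J" "bdd_above (u ` T)"
    and x: "x \<in> J"
  shows "u x = x * u 1"
proof -
  have zero: "0 \<in> J" using J by auto
  have down: "y \<in> J" if "z \<in> J" "0 \<le> y" "y \<le> z" for y z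
    using mem_is_interval_1_I[OF J(1) zero that] .
  note multiple = restricted_additive_multiple[OF J(1) zero add]
  obtain M where M: "\<And>t. t \<in> T \<Longrightarrow> u t \<le> M"
    using T(4) by (auto simp: bdd_above_def)
  obtain p q where pq: "p < q" and
    mid: "\<And>z. z \<in> {p..q} \<Longrightarrow> \<exists>x\<in>T. \<exists>y\<in>T. z = (x + y) / 2"
    using midpoints_contain_interval[OF T(1,2)] by blast
  have bound: "z \<in> J \<and> u z \<le> M" if z: "z \<in> {p..q}" for z
  proof -
    obtain s t where st: "s \<in> T" "t \<in> T" "z = s / 2 + t / 2"
      using mid[OF z] by (auto simp: add_divide_distrib)
    then have "s \<in> J" "t \<in> J" "s \<ge> 0" "t \<ge> 0" using T J by auto
    then have zJ: "z \<in> J" using st down[of s z] down[of t z] by (cases "s \<le> t") auto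
    have "u s = 2 * u (s / 2)" "u t = 2 * u (t / 2)"
      using multiple[of "s / 2" 2] multiple[of "t / 2" 2] \<open>s \<in> J\<close> \<open>t \<in> J\<close> \<open>s \<ge> 0\<close> \<open>t \<ge> 0\<close> by auto
    moreover have "u z = u (s / 2) + u (t / 2)"
      using add[of "s / 2" "t / 2"] st zJ \<open>s \<ge> 0\<close> \<open>t \<ge> 0\<close> by auto
    ultimately show ?thesis using zJ M[OF st(1)] M[OF st(2)] by linarith
  qed
  have pJ: "p \<in> J" "0 \<le> p" using bound[of p] pq J by auto
  define v where "v = (\<lambda>t. u t - t * u 1)"
  have v_add: "v (a + b) = v a + v b" if "0 \<le> a" "0 \<le> b" "a + b \<in> J" for a b
    using add[OF that] by (simp add: v_def algebra_simps)
  have "v x = 0"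
  proof (rule bounded_additive_vanishes[OF J(1,2) v_add])
    show "v 1 = 0" by (simp add: v_def)
    show "q - p > 0" using pq by simp
    fix t assume t: "0 \<le> t" "t \<le> q - p"
    have "u p + u t \<le> M" using bound[of "p + t"] add[OF pJ(2) t(1)] t by auto
    moreover have "- (t * u 1) \<le> (q - p) * \<bar>u 1\<bar>"
    proof -
      have "- (t * u 1) \<le> t * \<bar>u 1\<bar>"
        using mult_left_mono[OF abs_ge_minus_self[of "u 1"] t(1)] by simp
      also have "\<dots> \<le> (q - p) * \<bar>u 1\<bar>" using t by (intro mult_right_mono) auto
      finally show ?thesis .
    qed
    ultimately show "v t \<le> M - u p + (q - p) * \<bar>u 1\<bar>" by (simp add: v_def)
  qed (use x J in auto)
  then show ?thesis by (simp add: v_def)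
qed

lemma additive_one_sided_bounded_linear:
  fixes u :: "real \<Rightarrow> real"
  assumes J: "is_interval J" "{0..1} \<subseteq> J" "J \<subseteq> {0..}"
    and add: "\<And>a b. 0 \<le> a \<Longrightarrow> 0 \<le> b \<Longrightarrow> a + b \<in> J \<Longrightarrow> u (a + b) = u a + u b"
    and T: "T \<in> sets lebesgue" "emeasure lebesgue T > 0" "T \<subseteq> J"
    and bdd: "bdd_above (u ` T) \<or> bdd_below (u ` T)"
    and x: "x \<in> J"
  shows "u x = x * u 1"
  using bdd
proof
  assume "bdd_above (u ` T)"
  then show ?thesis by (intro additive_bdd_above_linear[where u = u and T = T, OF J add T _ x])
next
  assume "bdd_below (u ` T)"
  then have "bdd_above ((\<lambda>x. - u x) ` T)"
    by (auto simp: bdd_below_def bdd_above_def intro: le_imp_neg_le)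
  moreover have "- u (a + b) = - u a + - u b" if "0 \<le> a" "0 \<le> b" "a + b \<in> J" for a b
    using add[OF that] by simp
  ultimately have "- u x = x * - u 1"
    by (intro additive_bdd_above_linear[where u = "\<lambda>x. - u x" and T = T, OF J _ T _ x])
  then show ?thesis by simp
qed

text \<open>
  One-sided boundedness on a set of positive measure is the weakest of the regularity alternatives: a
  function continuous at a point is bounded near it, a monotone one on a compact interval, and
  for a measurable function the sublevel sets \<open>{u \<le> n}\<close> exhaust the domain, so that they cannot all be null.
\<close>

lemma weakly_regular_imp_one_sided_bounded:
  fixes u :: "real \<Rightarrow> real"
  assumes S: "is_interval S" "a < b" "a \<in> S" "b \<in> S" and u: "weakly_regular_on S u"
  obtains T where "T \<in> sets lebesgue" "T \<subseteq> S" "emeasure lebesgue T > 0"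
    "bdd_above (u ` T) \<or> bdd_below (u ` T)"
proof -
  have seg: "{p..q} \<subseteq> S" if "p \<in> S" "q \<in> S" for p q
    using mem_is_interval_1_I[OF S(1) that] by auto
  have pos: "emeasure lebesgue {p..q} > 0" if "p < q" for p q :: real
    using that by simp
  show thesis
    using u unfolding weakly_regular_on_def
  proof (elim disjE bexE conjE)
    fix x assume x: "x \<in> S" and cont: "continuous (at x within S) u"
    obtain d where d: "d > 0" "\<And>y. y \<in> S \<Longrightarrow> dist y x < d \<Longrightarrow> dist (u y) (u x) < 1"
      using cont unfolding continuous_within_eps_delta by (metis zero_less_one)
    \<comment> \<open>\<open>[A, B]\<close> is a nondegenerate interval in \<open>S\<close> that contains \<open>x\<close>;
      \<open>[p, q]\<close> is its part near \<open>x\<close>.\<close>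
    define A where "A = min a x"
    define B where "B = max b x"
    have AB: "A \<le> x" "x \<le> B" "A < B" "A \<in> S" "B \<in> S"
      using S x by (auto simp: A_def B_def min_def max_def)
    define p where "p = max (x - d / 2) A"
    define q where "q = min (x + d / 2) B"
    have p: "x - d / 2 \<le> p" "A \<le> p" and q: "q \<le> x + d / 2" "q \<le> B"
      by (simp_all add: p_def q_def)
    have "p < q" using AB d(1) by (simp add: p_def q_def)
    have sub: "{p..q} \<subseteq> S" using seg[OF AB(4,5)] p q by auto
    have "u y \<le> u x + 1" if "y \<in> {p..q}" for y
    proof -
      have "y \<in> S" using sub that by blast
      moreover have "dist y x < d"
        using that p q d(1) unfolding dist_real_def abs_less_iff by simp
      ultimately have "dist (u y) (u x) < 1" by (rule d(2))
      then show ?thesis unfolding dist_real_def abs_less_iff by simp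
    qed
    then have "bdd_above (u ` {p..q})" by (rule bdd_aboveI2)
    then show thesis using that[of "{p..q}"] sub pos[OF \<open>p < q\<close>] by simp
  next
    assume "mono_on S u"
    then have "u y \<le> u b" if "y \<in> {a..b}" for y
      using that seg[OF S(3,4)] S(4) by (auto simp: monotone_on_def)
    then have "bdd_above (u ` {a..b})" by (rule bdd_aboveI2)
    then show thesis using that[of "{a..b}"] seg[OF S(3,4)] pos[OF S(2)] by simp
  next
    assume "antimono_on S u"
    then have "u y \<le> u a" if "y \<in> {a..b}" for y
      using that seg[OF S(3,4)] S(3) by (auto simp: monotone_on_def)
    then have "bdd_above (u ` {a..b})" by (rule bdd_aboveI2)
    then show thesis using that[of "{a..b}"] seg[OF S(3,4)] pos[OF S(2)] by simp
  next
    assume meas: "u \<in> borel_measurable (lebesgue_on S)"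
    have Sb: "S \<in> sets lebesgue"
      using real_interval_borel_measurable[OF S(1)] by simp
    have level: "{x \<in> S. u x \<le> real n} \<in> sets lebesgue" for n :: nat
      using meas Sb borel_measurable_iff_halfspace_le[of u "lebesgue_on S"]
      by (simp add: space_restrict_space sets_restrict_space_iff)
    have "\<exists>n::nat. emeasure lebesgue {x \<in> S. u x \<le> real n} > 0"
    proof (rule ccontr)
      assume "\<not> ?thesis"
      then have "{x \<in> S. u x \<le> real n} \<in> null_sets lebesgue" for n :: nat
        using level by (auto simp: null_sets_def)
      then have "(\<Union>n::nat. {x \<in> S. u x \<le> real n}) \<in> null_sets lebesgue" by blast
      moreover have "(\<Union>n::nat. {x \<in> S. u x \<le> real n}) = S"
        using real_arch_simple by blast
      ultimately have "emeasure lebesgue S = 0" by auto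
      then have "emeasure lebesgue {a..b} \<le> 0"
        using emeasure_mono[OF seg[OF S(3,4)] Sb] by simp
      then show False using pos[OF S(2)] by simp
    qed
    then obtain n :: nat where "emeasure lebesgue {x \<in> S. u x \<le> real n} > 0" by blast
    moreover have "bdd_above (u ` {x \<in> S. u x \<le> real n})"
      by (rule bdd_aboveI2[of _ _ "real n"]) simp
    ultimately show thesis using that[OF level] by auto
  next
    fix T assume "T \<in> sets lebesgue" "T \<subseteq> S" "emeasure lebesgue T > 0" "bdd_above (u ` T)"
    then show thesis using that[of T] by simp
  next
    fix T assume "T \<in> sets lebesgue" "T \<subseteq> S" "emeasure lebesgue T > 0" "bdd_below (u ` T)"
    then show thesis using that[of T] by simp
  qed
qed

section \<open>Median-additive functions\<close>

lemma middle_value_eq: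
  assumes "0 \<le> c"
  shows "middle_value (- c) x c = max (- c) (min x c)"
proof -
  consider "x < - c" | "- c \<le> x" "x \<le> c" | "c < x" by linarith
  then show ?thesis
    by cases (use assms in \<open>simp_all add: middle_value_def max_def min_def\<close>)
qed

lemma ind_vec_nth [simp]: "ind_vec A $ i = (if i \<in> A then 1 else 0)"
  by (simp add: ind_vec_def)

lemma meet_vec_nth [simp]: "meet_vec x c $ i = min (x $ i) c"
  by (simp add: meet_vec_def)

lemma upper_excess_nth [simp]: "upper_excess x c $ i = x $ i - min (x $ i) c"
  by (simp add: upper_excess_def)

lemma lower_excess_nth [simp]: "lower_excess x c $ i = x $ i - max (x $ i) c"
  by (simp add: lower_excess_def join_vec_def)

lemma med_vec_nth [simp]: "0 \<le> c \<Longrightarrow> med_vec c x $ i = max (- c) (min (x $ i) c)"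
  by (simp add: med_vec_def middle_value_eq)

lemma pos_vec_nth [simp]: "pos_vec x $ i = max (x $ i) 0"
  by (simp add: pos_vec_def join_vec_def)

lemma neg_vec_nth [simp]: "neg_vec x $ i = max (- x $ i) 0"
  by (simp add: neg_vec_def)

lemma symmetric_interval_abs_le:
  assumes "is_interval I" "centered_at_0 I" "r \<in> I" "\<bar>s\<bar> \<le> \<bar>r\<bar>"
  shows "s \<in> (I :: real set)"
proof -
  have "- r \<in> I" using assms(2,3) by (auto simp: centered_at_0_def)
  then have "- \<bar>r\<bar> \<in> I" "\<bar>r\<bar> \<in> I" using assms(3) by (auto simp: abs_if)
  then show ?thesis
    by (rule mem_is_interval_1_I[OF assms(1)]) (use assms(4) in \<open>simp_all add: abs_le_iff\<close>)
qed

lemma cart_power_abs_le: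
  fixes x y :: "real ^ 'n"
  assumes "is_interval I" "centered_at_0 I" "x \<in> cart_power I" "\<And>i. \<bar>y $ i\<bar> \<le> \<bar>x $ i\<bar>"
  shows "y \<in> cart_power I"
  unfolding cart_power_def
proof clarify
  fix i show "y $ i \<in> I"
    using symmetric_interval_abs_le[OF assms(1,2) _ assms(4)] assms(3) by (simp add: cart_power_def)
qed

lemma median_parts_in_cart_power:
  fixes x :: "real ^ 'n"
  assumes "is_interval I" "centered_at_0 I" "x \<in> cart_power I" "0 \<le> c"
  shows "med_vec c x \<in> cart_power I" "upper_excess x c \<in> cart_power I"
    "lower_excess x (- c) \<in> cart_power I"
proof -
  have "\<bar>max (- c) (min t c)\<bar> \<le> \<bar>t\<bar>" "\<bar>t - min t c\<bar> \<le> \<bar>t\<bar>" "\<bar>t - max t (- c)\<bar> \<le> \<bar>t\<bar>" for t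
    using assms(4) by (auto simp: min_def max_def abs_if)
  then show "med_vec c x \<in> cart_power I" "upper_excess x c \<in> cart_power I"
    "lower_excess x (- c) \<in> cart_power I"
    using assms(4) by (auto intro!: cart_power_abs_le[OF assms(1-3)])
qed

lemma uminus_in_cart_power:
  "centered_at_0 I \<Longrightarrow> x \<in> cart_power I \<Longrightarrow> - x \<in> cart_power I"
  by (simp add: cart_power_def centered_at_0_def)

lemma median_additive_cong:
  fixes g h :: "real ^ 'n \<Rightarrow> real"
  assumes I: "is_interval I" "centered_at_0 I"
    and hma: "horizontally_median_additive_on I g"
    and eq: "\<And>x. x \<in> cart_power I \<Longrightarrow> g x = h x"
  shows "horizontally_median_additive_on I h"
  unfolding horizontally_median_additive_on_def
proof (intro ballI)
  fix x :: "real ^ 'n" and c assume xc: "x \<in> cart_power I" "c \<in> nonneg_part I"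
  then have "0 \<le> c" by (simp add: nonneg_part_def)
  moreover have "g x = g (med_vec c x) + g (upper_excess x c) + g (lower_excess x (- c))"
    using hma xc unfolding horizontally_median_additive_on_def by blast
  ultimately show "h x = h (med_vec c x) + h (upper_excess x c) + h (lower_excess x (- c))"
    using eq[OF xc(1)] eq[OF median_parts_in_cart_power(1)[OF I xc(1)]]
      eq[OF median_parts_in_cart_power(2)[OF I xc(1)]]
      eq[OF median_parts_in_cart_power(3)[OF I xc(1)]] by simp
qed

text \<open>
  This symmetry carries statements about nonnegative vectors and \<open>I\<^sub>+\<close> over to nonpositive
  vectors and \<open>I\<^sub>-\<close>.
\<close>

lemma median_additive_reflect:
  fixes g :: "real ^ 'n \<Rightarrow> real"
  assumes I: "centered_at_0 I" and hma: "horizontally_median_additive_on I g"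
  shows "horizontally_median_additive_on I (\<lambda>x. g (- x))"
  unfolding horizontally_median_additive_on_def
proof (intro ballI)
  fix x :: "real ^ 'n" and c assume x: "x \<in> cart_power I" and c: "c \<in> nonneg_part I"
  then have c0: "0 \<le> c" by (simp add: nonneg_part_def)
  have "med_vec c (- x) = - med_vec c x" "upper_excess (- x) c = - lower_excess x (- c)"
    "lower_excess (- x) (- c) = - upper_excess x c"
    using c0 by (simp_all add: vec_eq_iff min_def max_def)
  moreover have "g (- x) = g (med_vec c (- x)) + g (upper_excess (- x) c) + g (lower_excess (- x) (- c))"
    using hma c uminus_in_cart_power[OF I x]
    unfolding horizontally_median_additive_on_def by blast
  ultimately show "g (- x) = g (- med_vec c x) + g (- upper_excess x c) + g (- lower_excess x (- c))"
    by simp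
qed

lemma median_additive_zero:
  fixes g :: "real ^ 'n \<Rightarrow> real"
  assumes "0 \<in> I" and hma: "horizontally_median_additive_on I g"
  shows "g 0 = 0"
proof -
  \<comment> \<open>All three parts of the zero vector are zero, so \<open>g 0 = 3 * g 0\<close>.\<close>
  have "(0 :: real ^ 'n) \<in> cart_power I" "0 \<in> nonneg_part I"
    using assms(1) by (simp_all add: cart_power_def nonneg_part_def)
  then have "g 0 = g (med_vec 0 0) + g (upper_excess 0 0) + g (lower_excess 0 (- 0))"
    using hma unfolding horizontally_median_additive_on_def by blast
  moreover have "med_vec 0 0 = (0 :: real ^ 'n)" "upper_excess 0 0 = (0 :: real ^ 'n)"
    "lower_excess 0 (- 0) = (0 :: real ^ 'n)"
    by (simp_all add: vec_eq_iff)
  ultimately show ?thesis by simp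
qed

text \<open>
  On nonnegative vectors the lower excess is zero and the median is the meet with \<open>c\<close>, which
  leaves the two-part decomposition known as horizontal min-additivity.
\<close>

lemma median_additive_nonneg:
  fixes x :: "real ^ 'n"
  assumes "0 \<in> I" and hma: "horizontally_median_additive_on I g"
    and x: "x \<in> cart_power I" "\<And>i. 0 \<le> x $ i" and c: "c \<in> I" "0 \<le> c"
  shows "g x = g (meet_vec x c) + g (upper_excess x c)"
proof -
  have "med_vec c x = meet_vec x c" "lower_excess x (- c) = 0"
  proof -
    have "- c \<le> min (x $ i) c" "- c \<le> x $ i" for i using x(2)[of i] c by auto
    then show "med_vec c x = meet_vec x c" "lower_excess x (- c) = 0"
      using c by (simp_all add: vec_eq_iff max_absorb1 max_absorb2)
  qed
  moreover have "c \<in> nonneg_part I" using c by (simp add: nonneg_part_def)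
  then have "g x = g (med_vec c x) + g (upper_excess x c) + g (lower_excess x (- c))"
    using hma x(1) unfolding horizontally_median_additive_on_def by blast
  ultimately show ?thesis using median_additive_zero[OF assms(1,2)] by simp
qed


section \<open>Sections of median-additive functions along indicator vectors\<close>

text \<open>
  Cutting \<open>(a + b) 1\<^sub>A\<close> at height \<open>b\<close> leaves \<open>b 1\<^sub>A\<close> below and \<open>a 1\<^sub>A\<close> above.
\<close>

lemma median_additive_delta_additive:
  fixes g :: "real ^ 'n \<Rightarrow> real"
  assumes I: "is_interval I" "0 \<in> I" and hma: "horizontally_median_additive_on I g"
    and ab: "0 \<le> a" "0 \<le> b" "a + b \<in> I"
  shows "delta g A (a + b) = delta g A a + delta g A b"
proof -
  have "b \<in> I" using mem_is_interval_1_I[OF I ab(3)] ab by simp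
  moreover have "(a + b) *\<^sub>R ind_vec A \<in> cart_power I"
    using I ab by (simp add: cart_power_def)
  moreover have "0 \<le> ((a + b) *\<^sub>R ind_vec A) $ i" for i using ab by simp
  moreover have "meet_vec ((a + b) *\<^sub>R ind_vec A) b = b *\<^sub>R ind_vec A"
    "upper_excess ((a + b) *\<^sub>R ind_vec A) b = a *\<^sub>R ind_vec A"
    using ab by (simp_all add: vec_eq_iff min_def)
  ultimately show ?thesis
    using median_additive_nonneg[OF I(2) hma, of "(a + b) *\<^sub>R ind_vec A" b] ab by (simp add: delta_def)
qed

lemma median_additive_delta_linear:
  fixes g :: "real ^ 'n \<Rightarrow> real"
  assumes I: "is_interval I" "{-1..1} \<subseteq> I" and hma: "horizontally_median_additive_on I g"
    and T: "T \<in> sets lebesgue" "emeasure lebesgue T > 0" "T \<subseteq> nonneg_part I"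
    and bdd: "bdd_above (delta g A ` T) \<or> bdd_below (delta g A ` T)"
    and x: "x \<in> nonneg_part I"
  shows "delta g A x = x * delta g A 1"
proof (rule additive_one_sided_bounded_linear[where J = "nonneg_part I" and T = T])
  show "is_interval (nonneg_part I)"
    unfolding nonneg_part_def by (intro is_interval_Int I(1) is_interval_ci)
  show "{0..1} \<subseteq> nonneg_part I" using I(2) by (auto simp: nonneg_part_def)
  show "nonneg_part I \<subseteq> {0..}" by (auto simp: nonneg_part_def)
  have "0 \<in> I" using I(2) by auto
  fix a b :: real assume "0 \<le> a" "0 \<le> b" "a + b \<in> nonneg_part I"
  then show "delta g A (a + b) = delta g A a + delta g A b"
    using median_additive_delta_additive[OF I(1) \<open>0 \<in> I\<close> hma] by (simp add: nonneg_part_def)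
qed (use T bdd x in auto)

lemma homogeneous_on_iff_linear:
  assumes "1 \<in> I"
  shows "homogeneous_on I u \<longleftrightarrow> (\<forall>x\<in>I. u x = x * u 1)"
proof
  assume "homogeneous_on I u"
  then show "\<forall>x\<in>I. u x = x * u 1"
    using assms unfolding homogeneous_on_def by (metis mult.right_neutral)
next
  assume lin: "\<forall>x\<in>I. u x = x * u 1"
  then show "homogeneous_on I u" unfolding homogeneous_on_def by (simp add: mult.assoc)
qed

text \<open>
  A linear function is monotone, in the direction given by the sign of its slope.
\<close>

lemma linear_imp_weakly_regular:
  assumes "\<And>x. x \<in> S \<Longrightarrow> u x = x * k"
  shows "weakly_regular_on S u"
proof -
  have "mono_on S u \<or> antimono_on S u"
  proof (cases "0 \<le> k")
    case True
    then have "mono_on S u" using assms by (simp add: monotone_on_def mult_right_mono)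
    then show ?thesis ..
  next
    case False
    then have "antimono_on S u" using assms by (simp add: monotone_on_def mult_right_mono_neg)
    then show ?thesis ..
  qed
  then show ?thesis unfolding weakly_regular_on_def by blast
qed

text \<open>
  Regularity makes the additive function \<open>delta g A\<close> linear on each of the two halves of \<open>I\<close>,
  where the slopes are \<open>delta g A 1\<close> and \<open>- delta g A (-1)\<close>; oddness at \<open>1\<close> says that these slopes are equal.
\<close>

lemma median_additive_regular_iff_homogeneous:
  fixes g :: "real ^ 'n \<Rightarrow> real"
  assumes I: "is_interval I" "centered_at_0 I" "{-1..1} \<subseteq> I"
    and hma: "horizontally_median_additive_on I g"
  shows "weakly_regular_on (nonneg_part I) (delta g A) \<and>
         weakly_regular_on (nonpos_part I) (delta g A) \<and>
         delta g A (-1) = - delta g A 1 \<longleftrightarrow> homogeneous_on I (delta g A)" (is "?L \<longleftrightarrow> ?R")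
proof
  have one: "1 \<in> I" and zero: "0 \<in> I" and mone: "-1 \<in> I" using I(3) by auto
  assume ?R
  then have lin: "\<And>x. x \<in> I \<Longrightarrow> delta g A x = x * delta g A 1"
    using homogeneous_on_iff_linear[OF one] by blast
  then have "weakly_regular_on (nonneg_part I) (delta g A)"
    "weakly_regular_on (nonpos_part I) (delta g A)"
    by (auto simp: nonneg_part_def nonpos_part_def intro!: linear_imp_weakly_regular)
  then show ?L using lin[OF mone] by simp
next
  have one: "1 \<in> I" and zero: "0 \<in> I" and mone: "-1 \<in> I" using I(3) by auto
  assume L: ?L
  have half: "is_interval (nonneg_part I)" "is_interval (nonpos_part I)"
    unfolding nonneg_part_def nonpos_part_def
    by (intro is_interval_Int I(1) is_interval_ci is_interval_ic)+
  have pos: "delta g A x = x * delta g A 1" if x: "x \<in> nonneg_part I" for x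
  proof -
    obtain T where T: "T \<in> sets lebesgue" "T \<subseteq> nonneg_part I" "emeasure lebesgue T > 0"
      "bdd_above (delta g A ` T) \<or> bdd_below (delta g A ` T)"
    proof (rule weakly_regular_imp_one_sided_bounded[OF half(1)])
      show "0 \<in> nonneg_part I" "1 \<in> nonneg_part I" using one zero by (auto simp: nonneg_part_def)
      show "weakly_regular_on (nonneg_part I) (delta g A)" using L by blast
    qed auto
    show ?thesis by (rule median_additive_delta_linear[OF I(1,3) hma T(1,3,2,4) x])
  qed
  have neg: "delta g A (- x) = x * delta g A (-1)" if x: "x \<in> nonneg_part I" for x
  proof -
    let ?h = "\<lambda>x. g (- x)"
    have h: "delta ?h A t = delta g A (- t)" for t by (simp add: delta_def)
    obtain T where T: "T \<in> sets lebesgue" "T \<subseteq> nonpos_part I" "emeasure lebesgue T > 0"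
      "bdd_above (delta g A ` T) \<or> bdd_below (delta g A ` T)"
    proof (rule weakly_regular_imp_one_sided_bounded[OF half(2)])
      show "-1 \<in> nonpos_part I" "0 \<in> nonpos_part I" using mone zero by (auto simp: nonpos_part_def)
      show "weakly_regular_on (nonpos_part I) (delta g A)" using L by blast
    qed auto
    have T': "uminus ` T \<in> sets lebesgue" by (rule sets_lebesgue_reflect[OF T(1)])
    have pos': "emeasure lebesgue (uminus ` T) > 0"
      using T(3) emeasure_lebesgue_affine[of "-1" 0 T] by simp
    have sub: "uminus ` T \<subseteq> nonneg_part I"
      using T(2) I(2) by (auto simp: nonneg_part_def nonpos_part_def centered_at_0_def)
    have "delta ?h A ` uminus ` T = delta g A ` T"
      by (simp add: h image_image)
    then have "bdd_above (delta ?h A ` uminus ` T) \<or> bdd_below (delta ?h A ` uminus ` T)"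
      using T(4) by simp
    then have "delta ?h A x = x * delta ?h A 1"
      by (rule median_additive_delta_linear[OF I(1,3) median_additive_reflect[OF I(2) hma] T' pos' sub _ x])
    then show ?thesis by (simp add: h)
  qed
  have "delta g A x = x * delta g A 1" if x: "x \<in> I" for x
  proof (cases "0 \<le> x")
    case True
    then show ?thesis using pos x by (simp add: nonneg_part_def)
  next
    case False
    then have "- x \<in> nonneg_part I" using x I(2) by (simp add: nonneg_part_def centered_at_0_def)
    then show ?thesis using neg[of "- x"] L by simp
  qed
  then show ?R using homogeneous_on_iff_linear[OF one] by blast
qed

text \<open>
  A nonnegative vector is a sum of multiples of indicators of its upper level sets, and
  min-additivity makes the value at the vector the sum of the values at these multiples. The induction
  peels off one level at a time.
\<close>

lemma median_additive_eq_on_nonneg: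
  fixes g h :: "real ^ 'n \<Rightarrow> real"
  assumes I: "is_interval I" "centered_at_0 I" "0 \<in> I"
    and g: "horizontally_median_additive_on I g" and h: "horizontally_median_additive_on I h"
    and eq: "\<And>A t. t \<in> I \<Longrightarrow> delta g A t = delta h A t"
    and x: "x \<in> cart_power I" "\<And>i. 0 \<le> x $ i"
  shows "g x = h x"
  using x
proof (induction "card {i. x $ i \<noteq> 0}" arbitrary: x rule: less_induct)
  case less
  define P where "P = {i. x $ i \<noteq> 0}"
  show ?case
  proof (cases "P = {}")
    case True
    then have "x = 0" by (simp add: P_def vec_eq_iff)
    then show ?thesis using median_additive_zero[OF I(3) g] median_additive_zero[OF I(3) h] by simp
  next
    case False
    define c where "c = Min (($) x ` P)"
    have c_le: "c \<le> x $ i" if "i \<in> P" for i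
      unfolding c_def using that by (intro Min_le) auto
    have "c \<in> ($) x ` P" unfolding c_def using False by (intro Min_in) auto
    then obtain k where k: "k \<in> P" "x $ k = c" by auto
    then have c: "c \<in> I" "0 < c"
      using less.prems by (auto simp: P_def cart_power_def order.strict_iff_order)
    \<comment> \<open>Cutting at the least nonzero entry leaves a multiple of the indicator of the support below
      the cut, and above it a vector of smaller support.\<close>
    have meet: "meet_vec x c = c *\<^sub>R ind_vec P"
      using c_le c(2) by (auto simp: vec_eq_iff P_def min_def order.antisym)
    have up: "upper_excess x c \<in> cart_power I"
      using median_parts_in_cart_power(2)[OF I(1,2) less.prems(1)] c by simp
    have "{i. upper_excess x c $ i \<noteq> 0} \<subset> P"
    proof
      show "{i. upper_excess x c $ i \<noteq> 0} \<subseteq> P" using c(2) by (auto simp: P_def)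
      have "upper_excess x c $ k = 0" using k by simp
      then show "{i. upper_excess x c $ i \<noteq> 0} \<noteq> P" using k(1) by blast
    qed
    then have "card {i. upper_excess x c $ i \<noteq> 0} < card {i. x $ i \<noteq> 0}"
      unfolding P_def[symmetric] by (intro psubset_card_mono) auto
    then have "g (upper_excess x c) = h (upper_excess x c)"
      using less.hyps up by simp
    moreover have "g (meet_vec x c) = h (meet_vec x c)"
      using eq[OF c(1), of P] by (simp add: meet delta_def)
    ultimately show ?thesis
      using median_additive_nonneg[OF I(3) g less.prems c(1)] median_additive_nonneg[OF I(3) h less.prems c(1)] c(2)
      by simp
  qed
qed

text \<open>
  Cutting at height \<open>0\<close> separates the positive and the negative part of a vector, and each of
  them has entries of one sign only.
\<close>

lemma median_additive_eq_if_delta_eq: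
  fixes g h :: "real ^ 'n \<Rightarrow> real"
  assumes I: "is_interval I" "centered_at_0 I" "0 \<in> I"
    and g: "horizontally_median_additive_on I g" and h: "horizontally_median_additive_on I h"
    and eq: "\<And>A t. t \<in> I \<Longrightarrow> delta g A t = delta h A t"
    and x: "x \<in> cart_power I"
  shows "g x = h x"
proof -
  note parts = median_parts_in_cart_power[OF I(1,2) x order_refl]
  have pos: "g (upper_excess x 0) = h (upper_excess x 0)"
    by (rule median_additive_eq_on_nonneg[OF I g h eq parts(2)]) (simp_all add: min_def)
  have "g (- (- lower_excess x (- 0))) = h (- (- lower_excess x (- 0)))"
  proof (rule median_additive_eq_on_nonneg[OF I median_additive_reflect[OF I(2) g] median_additive_reflect[OF I(2) h]])
    show "- lower_excess x (- 0) \<in> cart_power I" by (rule uminus_in_cart_power[OF I(2) parts(3)])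
    show "0 \<le> (- lower_excess x (- 0)) $ i" for i by (simp add: max_def)
    fix A and t :: real assume "t \<in> I"
    then have "delta g A (- t) = delta h A (- t)"
      using eq I(2) by (simp add: centered_at_0_def)
    then show "delta (\<lambda>x. g (- x)) A t = delta (\<lambda>x. h (- x)) A t" by (simp add: delta_def)
  qed
  then have neg: "g (lower_excess x (- 0)) = h (lower_excess x (- 0))" by simp
  have "med_vec 0 x = 0" by (simp add: vec_eq_iff)
  then have med: "g (med_vec 0 x) = h (med_vec 0 x)" using median_additive_zero[OF I(3) g] median_additive_zero[OF I(3) h] by simp
  have z: "0 \<in> nonneg_part I" using I(3) by (simp add: nonneg_part_def)
  have "g x = g (med_vec 0 x) + g (upper_excess x 0) + g (lower_excess x (- 0))"
    using g x z unfolding horizontally_median_additive_on_def by blast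
  also have "\<dots> = h x"
    unfolding med pos neg using h x z unfolding horizontally_median_additive_on_def by force
  finally show ?thesis .
qed


section \<open>Symmetric Lovasz extensions\<close>

lemma lovasz_extension_linear_on_sorted_region:
  fixes \<sigma> :: "'n::{finite,linorder} \<Rightarrow> 'n"
  assumes "\<sigma> permutes UNIV"
  obtains l where "linear l"
    "\<And>y. y \<in> sorted_region \<sigma> \<Longrightarrow> lovasz_extension \<phi> y = l y + lovasz_extension \<phi> 0"
proof -
  obtain g where g: "affine_map g" "\<forall>x\<in>sorted_region \<sigma>. lovasz_extension \<phi> x = g x"
    using is_lovasz_extension_of_lovasz_extension[of \<phi>] assms
    unfolding is_lovasz_extension_of_def by blast
  obtain l b where l: "linear l" "g = (\<lambda>x. l x + b)" using g(1) by (auto simp: affine_map_def)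
  have "(0 :: real ^ 'n::_) \<in> sorted_region \<sigma>" by (simp add: sorted_region_def mono_def)
  then have "lovasz_extension \<phi> 0 = b" using g(2) l by (simp add: linear_0)
  then show thesis using that[OF l(1)] g(2) l(2) by simp
qed

lemma lovasz_extension_eq_at_ind_vec:
  fixes \<phi> :: "real ^ 'n::{finite,linorder} \<Rightarrow> real"
  shows "lovasz_extension \<phi> (ind_vec A) = \<phi> (ind_vec A)"
proof -
  obtain \<sigma> :: "'n \<Rightarrow> 'n" where \<sigma>: "\<sigma> permutes UNIV" "ind_vec A \<in> sorted_region \<sigma>"
    using ex_sorted_region by blast
  have "(ind_vec A :: real ^ 'n::_) extreme_point_of (cbox 0 1 \<inter> sorted_region \<sigma>)"
    using \<sigma>(2) by (simp add: extreme_point_iff_zero_one[OF \<sigma>(1)])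
  then show ?thesis
    using is_lovasz_extension_of_lovasz_extension[of \<phi>] \<sigma>
    unfolding is_lovasz_extension_of_def by metis
qed

text \<open>
  Truncating at \<open>c\<close> and taking the excess over \<open>c\<close> are increasing operations on the entries, so
  \<open>x\<close> and both of its parts lie in one sorted cone, on which the Lovasz extension is affine.
\<close>

lemma lovasz_extension_split:
  fixes x :: "real ^ 'n::{finite,linorder}"
  shows "lovasz_extension \<phi> x + lovasz_extension \<phi> 0 =
    lovasz_extension \<phi> (meet_vec x c) + lovasz_extension \<phi> (upper_excess x c)"
proof -
  obtain \<sigma> :: "'n \<Rightarrow> 'n" where \<sigma>: "\<sigma> permutes UNIV" and x: "x \<in> sorted_region \<sigma>"
    using ex_sorted_region by blast
  obtain l where l: "linear l"
    "\<And>y. y \<in> sorted_region \<sigma> \<Longrightarrow> lovasz_extension \<phi> y = l y + lovasz_extension \<phi> 0"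
    using lovasz_extension_linear_on_sorted_region[OF \<sigma>, of \<phi>] by blast
  have "mono (\<lambda>t::real. min t c)" "mono (\<lambda>t::real. t - min t c)"
    by (auto simp: mono_def min_def)
  then have "meet_vec x c \<in> sorted_region \<sigma>" "upper_excess x c \<in> sorted_region \<sigma>"
    using x unfolding sorted_region_def by (simp_all add: mono_def)
  moreover have "l x = l (meet_vec x c) + l (upper_excess x c)"
    using linear_add[OF l(1), of "meet_vec x c" "upper_excess x c"] by (simp add: upper_excess_def)
  ultimately show ?thesis using l(2) x by simp
qed

text \<open>
  A nonnegative scalar keeps \<open>x\<close> in its sorted cone; a negative one would reverse the order of the
  entries.
\<close>

lemma lovasz_extension_scale:
  fixes x :: "real ^ 'n::{finite,linorder}"
  assumes "0 \<le> t"
  shows "lovasz_extension \<phi> (t *\<^sub>R x) - lovasz_extension \<phi> 0 =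
    t * (lovasz_extension \<phi> x - lovasz_extension \<phi> 0)"
proof -
  obtain \<sigma> :: "'n \<Rightarrow> 'n" where \<sigma>: "\<sigma> permutes UNIV" and x: "x \<in> sorted_region \<sigma>"
    using ex_sorted_region by blast
  obtain l where l: "linear l"
    "\<And>y. y \<in> sorted_region \<sigma> \<Longrightarrow> lovasz_extension \<phi> y = l y + lovasz_extension \<phi> 0"
    using lovasz_extension_linear_on_sorted_region[OF \<sigma>, of \<phi>] by blast
  have "t *\<^sub>R x \<in> sorted_region \<sigma>"
    using x assms by (simp add: sorted_region_def mono_def mult_left_mono)
  then show ?thesis using l x linear_scale[OF l(1), of t x] by simp
qed

lemma symmetric_lovasz_extension_zero:
  fixes \<phi> :: "real ^ 'n::{finite,linorder} \<Rightarrow> real"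
  shows "symmetric_lovasz_extension \<phi> 0 = lovasz_extension \<phi> 0"
proof -
  have "pos_vec 0 = (0 :: real ^ 'n::_)" "neg_vec 0 = (0 :: real ^ 'n::_)"
    by (simp_all add: vec_eq_iff)
  then show ?thesis by (simp add: symmetric_lovasz_extension_def)
qed

text \<open>
  Less its value at \<open>0\<close>, the symmetric extension is homogeneous for negative scalars too, since these interchange the
  positive and the negative part of \<open>x\<close>.
\<close>

lemma symmetric_lovasz_extension_scale:
  fixes x :: "real ^ 'n::{finite,linorder}"
  shows "symmetric_lovasz_extension \<phi> (t *\<^sub>R x) - symmetric_lovasz_extension \<phi> 0 =
    t * (symmetric_lovasz_extension \<phi> x - symmetric_lovasz_extension \<phi> 0)"
proof (cases "0 \<le> t")
  case True
  then have "pos_vec (t *\<^sub>R x) = t *\<^sub>R pos_vec x" "neg_vec (t *\<^sub>R x) = t *\<^sub>R neg_vec x"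
    by (simp_all add: vec_eq_iff max_mult_distrib_left)
  then show ?thesis
    using lovasz_extension_scale[OF True, of \<phi> "pos_vec x"]
      lovasz_extension_scale[OF True, of \<phi> "neg_vec x"]
    unfolding symmetric_lovasz_extension_zero
    by (simp add: symmetric_lovasz_extension_def algebra_simps)
next
  case False
  define s where "s = - t"
  have s: "0 \<le> s" "t = - s" using False by (auto simp: s_def)
  have "pos_vec (t *\<^sub>R x) = s *\<^sub>R neg_vec x" "neg_vec (t *\<^sub>R x) = s *\<^sub>R pos_vec x"
    using s by (simp_all add: vec_eq_iff max_mult_distrib_left)
  then show ?thesis
    using lovasz_extension_scale[OF s(1), of \<phi> "pos_vec x"]
      lovasz_extension_scale[OF s(1), of \<phi> "neg_vec x"] s(2)
    unfolding symmetric_lovasz_extension_zero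
    by (simp add: symmetric_lovasz_extension_def algebra_simps)
qed

text \<open>
  Truncation commutes with taking positive and negative parts: the median keeps the truncations of
  both, the upper excess has only a positive part and the lower excess only a negative one.
\<close>

lemma symmetric_lovasz_extension_median_additive:
  fixes \<phi> :: "real ^ 'n::{finite,linorder} \<Rightarrow> real"
  shows "horizontally_median_additive_on I
    (\<lambda>x. symmetric_lovasz_extension \<phi> x - symmetric_lovasz_extension \<phi> 0)"
  unfolding horizontally_median_additive_on_def
proof (intro ballI)
  fix x :: "real ^ 'n::_" and c assume "c \<in> nonneg_part I"
  then have c: "0 \<le> c" by (simp add: nonneg_part_def)
  have "pos_vec (med_vec c x) = meet_vec (pos_vec x) c"
    "neg_vec (med_vec c x) = meet_vec (neg_vec x) c"
    "pos_vec (upper_excess x c) = upper_excess (pos_vec x) c"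
    "neg_vec (upper_excess x c) = 0"
    "pos_vec (lower_excess x (- c)) = 0"
    "neg_vec (lower_excess x (- c)) = upper_excess (neg_vec x) c"
    using c by (auto simp: vec_eq_iff min_def max_def)
  then show "symmetric_lovasz_extension \<phi> x - symmetric_lovasz_extension \<phi> 0 =
      (symmetric_lovasz_extension \<phi> (med_vec c x) - symmetric_lovasz_extension \<phi> 0) +
      (symmetric_lovasz_extension \<phi> (upper_excess x c) - symmetric_lovasz_extension \<phi> 0) +
      (symmetric_lovasz_extension \<phi> (lower_excess x (- c)) - symmetric_lovasz_extension \<phi> 0)"
    using lovasz_extension_split[of \<phi> "pos_vec x" c] lovasz_extension_split[of \<phi> "neg_vec x" c]
    unfolding symmetric_lovasz_extension_zero by (simp add: symmetric_lovasz_extension_def)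
qed

lemma symmetric_lovasz_extension_ind_vec:
  fixes \<phi> :: "real ^ 'n::{finite,linorder} \<Rightarrow> real"
  shows "symmetric_lovasz_extension \<phi> (ind_vec A) = \<phi> (ind_vec A)"
proof -
  have "pos_vec (ind_vec A) = (ind_vec A :: real ^ 'n::_)" "neg_vec (ind_vec A) = (0 :: real ^ 'n::_)"
    by (simp_all add: vec_eq_iff)
  then show ?thesis
    by (simp add: symmetric_lovasz_extension_def lovasz_extension_eq_at_ind_vec)
qed

text \<open>
  In the backward direction the set function \<open>\<phi>\<close> is \<open>f\<close> itself, read on \<open>0/1\<close>-vectors: then \<open>f\<close> and
  its symmetric Lovasz extension agree at \<open>0\<close> and at all indicators, by homogeneity at all their multiples
  in \<open>I\<^sup>n\<close>, and so on all of \<open>I\<^sup>n\<close>.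
\<close>

lemma symmetric_lovasz_iff_median_additive_homogeneous:
  fixes f :: "real ^ 'n::{finite,linorder} \<Rightarrow> real"
  assumes I: "is_interval I" "centered_at_0 I" "{-1..1} \<subseteq> I"
  shows "is_symmetric_lovasz_extension_on I f \<longleftrightarrow>
    horizontally_median_additive_on I (\<lambda>x. f x - f 0) \<and>
    (\<forall>A. homogeneous_on I (delta (\<lambda>x. f x - f 0) A))"
proof
  have one: "1 \<in> I" and zero: "0 \<in> I" using I(3) by auto
  assume "is_symmetric_lovasz_extension_on I f"
  then obtain \<phi> where \<phi>: "\<And>x. x \<in> cart_power I \<Longrightarrow> f x = symmetric_lovasz_extension \<phi> x"
    unfolding is_symmetric_lovasz_extension_on_def by blast
  have z: "0 \<in> cart_power I" using zero by (simp add: cart_power_def)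
  then have eq: "symmetric_lovasz_extension \<phi> x - symmetric_lovasz_extension \<phi> 0 = f x - f 0"
    if "x \<in> cart_power I" for x
    using \<phi>[OF z] \<phi>[OF that] by simp
  have "homogeneous_on I (delta (\<lambda>x. f x - f 0) A)" for A
    unfolding homogeneous_on_iff_linear[OF one]
  proof
    fix t assume t: "t \<in> I"
    have "s *\<^sub>R ind_vec A \<in> cart_power I" if "s \<in> I" for s
      using that zero by (simp add: cart_power_def)
    then have d: "delta (\<lambda>x. f x - f 0) A s = symmetric_lovasz_extension \<phi> (s *\<^sub>R ind_vec A)
        - symmetric_lovasz_extension \<phi> 0" if "s \<in> I" for s
      using eq that by (simp add: delta_def)
    show "delta (\<lambda>x. f x - f 0) A t = t * delta (\<lambda>x. f x - f 0) A 1"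
      unfolding d[OF t] d[OF one] symmetric_lovasz_extension_scale[of \<phi> t] by simp
  qed
  then show "horizontally_median_additive_on I (\<lambda>x. f x - f 0) \<and>
    (\<forall>A. homogeneous_on I (delta (\<lambda>x. f x - f 0) A))"
    using median_additive_cong[OF I(1,2) symmetric_lovasz_extension_median_additive eq] by blast
next
  have one: "1 \<in> I" and zero: "0 \<in> I" using I(3) by auto
  assume R: "horizontally_median_additive_on I (\<lambda>x. f x - f 0) \<and>
    (\<forall>A. homogeneous_on I (delta (\<lambda>x. f x - f 0) A))"
  let ?S = "symmetric_lovasz_extension f"
  have ind0: "ind_vec {} = (0 :: real ^ 'n::_)" by (simp add: vec_eq_iff)
  have S0: "?S 0 = f 0" using symmetric_lovasz_extension_ind_vec[of f "{}"] by (simp add: ind0)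
  have "f x - f 0 = ?S x - ?S 0" if x: "x \<in> cart_power I" for x
  proof (rule median_additive_eq_if_delta_eq[OF I(1,2) zero _ symmetric_lovasz_extension_median_additive _ x])
    show "horizontally_median_additive_on I (\<lambda>x. f x - f 0)" using R by blast
    fix A t assume t: "t \<in> I"
    have "delta (\<lambda>x. f x - f 0) A t = t * delta (\<lambda>x. f x - f 0) A 1"
      using R t homogeneous_on_iff_linear[OF one] by blast
    also have "\<dots> = t * (?S (ind_vec A) - ?S 0)"
      by (simp add: delta_def S0 symmetric_lovasz_extension_ind_vec)
    also have "\<dots> = delta (\<lambda>x. ?S x - ?S 0) A t"
      by (simp add: delta_def symmetric_lovasz_extension_scale)
    finally show "delta (\<lambda>x. f x - f 0) A t = delta (\<lambda>x. ?S x - ?S 0) A t" .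
  qed
  then show "is_symmetric_lovasz_extension_on I f"
    unfolding is_symmetric_lovasz_extension_on_def using S0 by auto
qed

theorem theorem11:
  fixes I :: "real set"
    and f :: "real ^ 'n::{finite,linorder} \<Rightarrow> real"
    and f\<^sub>0 :: "real ^ 'n::_ \<Rightarrow> real"
  assumes "is_interval I" and "emeasure lebesgue I > 0" and "0 \<in> I"
    and "centered_at_0 I" and "{-1..1} \<subseteq> I"
    and "f\<^sub>0 = (\<lambda>x. f x - f 0)"
  shows "(is_symmetric_lovasz_extension_on I f \<longleftrightarrow>
           horizontally_median_additive_on I f\<^sub>0 \<and>
           (\<forall>A. weakly_regular_on (nonneg_part I) (delta f\<^sub>0 A) \<and>
                weakly_regular_on (nonpos_part I) (delta f\<^sub>0 A)) \<and>
           (\<forall>A. delta f\<^sub>0 A (-1) = - delta f\<^sub>0 A 1)) \<and>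
         (horizontally_median_additive_on I f\<^sub>0 \<longrightarrow>
           ((\<forall>A. weakly_regular_on (nonneg_part I) (delta f\<^sub>0 A) \<and>
                 weakly_regular_on (nonpos_part I) (delta f\<^sub>0 A)) \<and>
            (\<forall>A. delta f\<^sub>0 A (-1) = - delta f\<^sub>0 A 1)
            \<longleftrightarrow> (\<forall>A. homogeneous_on I (delta f\<^sub>0 A))))"
proof -
  have reg: "(\<forall>A. weakly_regular_on (nonneg_part I) (delta f\<^sub>0 A) \<and>
                 weakly_regular_on (nonpos_part I) (delta f\<^sub>0 A)) \<and>
            (\<forall>A. delta f\<^sub>0 A (-1) = - delta f\<^sub>0 A 1)
            \<longleftrightarrow> (\<forall>A. homogeneous_on I (delta f\<^sub>0 A))"
    if "horizontally_median_additive_on I f\<^sub>0"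
    using median_additive_regular_iff_homogeneous[OF assms(1,4,5) that] by blast
  moreover have "is_symmetric_lovasz_extension_on I f \<longleftrightarrow>
      horizontally_median_additive_on I f\<^sub>0 \<and> (\<forall>A. homogeneous_on I (delta f\<^sub>0 A))"
    unfolding assms(6) by (rule symmetric_lovasz_iff_median_additive_homogeneous[OF assms(1,4,5)])
  ultimately show ?thesis by blast
qed

end
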